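(* Let $\mathsf{AP}$ be any finite set of atomic propositions. Then $\mathsf{LTL}_{\hat{\mathsf{F}},\land,\lor,\top,\bot}[\mathsf{AP}]$ admits finite characterizations (over $\mathcal{W}^{\mathsf{all}}$). In fact, every formula $\varphi$ in this fragment is uniquely characterized, with respect to $\mathsf{LTL}_{\hat{\mathsf{F}},\land,\lor,\top,\bot}[\mathsf{AP}]$, by a finite set of labeled examples whose words are finitely presentable and of ordinal length less than $\omega^2$.
   Context: Words: for a countable ordinal $\alpha$, an $\alpha$-word is a function $w:\alpha\to\mathcal{P}(\mathsf{AP})$; $|w|=\alpha$; for $\beta<|w|$, $w[\beta..]$ is the suffix $w'$ with $w'[\gamma]=w[\beta+\gamma]$ (of length the unique $\gamma_0$ with $\beta+\gamma_0=|w|$). $\mathcal{W}^{\mathsf{all}}$: all words of countable ordinal length. Finitely presentable words: word-expressions are generated by: each $\sigma\subseteq\mathsf{AP}$ (denoting the one-letter word $\sigma$); $A\cdot B$ (concatenation: if $A$ denotes an $\alpha$-word $w_A$ and $B$ a $\beta$-word $w_B$, it denotes the $(\alpha+\beta)$-word equal to $w_A[\gamma]$ for $\gamma<\alpha$ and $w_B[\gamma-\alpha]$ otherwise); $(A)^\omega$ (denoting the $(\alpha\cdot\omega)$-word $\gamma\mapsto w_A[\gamma\bmod\alpha]$). A word is finitely presentable if denoted by some word-expression. Semantics: $w\models\top$ always, $w\not\models\bot$; $w\models p$ iff $p\in w[0]$; $\land,\lor$ as usual; $\hat{\mathsf{F}}\varphi$ abbreviates $\mathsf{X}\mathsf{F}\varphi$,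 where $w\models\mathsf{X}\psi$ iff $|w|>1$ and $w[1..]\models\psi$, and $w\models\mathsf{F}\psi$ iff there is $\alpha<|w|$ with $w[\alpha..]\models\psi$. $\mathsf{LTL}_{\hat{\mathsf{F}},\land,\lor,\top,\bot}[\mathsf{AP}]$ is the set of formulas built from atomic propositions of $\mathsf{AP}$ using only $\hat{\mathsf{F}},\land,\lor,\top,\bot$. $[\![\varphi]\!]$ is the set of words in $\mathcal{W}^{\mathsf{all}}$ satisfying $\varphi$. A labeled example is $(w,\ell)$, $\ell\in\{+,-\}$; $\varphi$ fits it if ($w\models\varphi$ and $\ell=+$) or ($w\not\models\varphi$ and $\ell=-$). A set $E$ uniquely characterizes $\varphi$ w.r.t. a fragment $\mathcal{L}$ if $\varphi$ fits every example in $E$ and every $\psi\in\mathcal{L}$ that fits every example in $E$ satisfies $[\![\psi]\!]=[\![\varphi]\!]$. A fragment admits finite characterizations if every formula in it is uniquely characterized with respect to it by some finite set of labeled examples. *)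

theory Defs
  imports "HOL-Library.Countable_Set_Type" "HOL-Library.FuncSet"
begin

unbundle cardinal_syntax

text \<open>
  The elements of the first uncountable ordinal, which the library provides as the
  initial well-order \<open>cardSuc natLeq\<close>, are exactly the countable ordinals: see
  \<open>countable_lessThan_cord\<close> and \<open>Well_order_ordIso_cord\<close> below.
\<close>

typedef cord = "Field (cardSuc natLeq)"
  using Field_cardSuc_not_empty[OF natLeq_Card_order] by blast

instantiation cord :: linorder
begin

definition "a \<le> b \<longleftrightarrow> (Rep_cord a, Rep_cord b) \<in> cardSuc natLeq"
definition "(a :: cord) < b \<longleftrightarrow> a \<le> b \<and> \<not> b \<le> a"

lemma cord_Well_order: "Well_order (cardSuc natLeq)"
  using cardSuc_Card_order[OF natLeq_Card_order] card_order_on_well_order_on by blast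

instance
proof
  let ?r = "cardSuc natLeq"
  have r: "refl_on (Field ?r) ?r" "trans ?r" "antisym ?r" "total_on (Field ?r) ?r"
    using cord_Well_order by (auto simp: order_on_defs)
  fix x y z :: cord
  show "(x < y) = (x \<le> y \<and> \<not> y \<le> x)" by (rule less_cord_def)
  show "x \<le> x" using r(1) Rep_cord by (auto simp: less_eq_cord_def refl_on_def)
  show "x \<le> z" if "x \<le> y" "y \<le> z"
    using that r(2) unfolding less_eq_cord_def by (blast dest: transD)
  show "x = y" if "x \<le> y" "y \<le> x"
    using that r(3) unfolding less_eq_cord_def by (metis antisymD Rep_cord_inject)
  show "x \<le> y \<or> y \<le> x"
    using r(1,4) Rep_cord[of x] Rep_cord[of y] unfolding less_eq_cord_def total_on_def
    by (metis refl_onD)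
qed

end

instance cord :: wellorder
proof
  fix P :: "cord \<Rightarrow> bool" and a
  assume step: "\<And>x. (\<And>y. y < x \<Longrightarrow> P y) \<Longrightarrow> P x"
  have "wf (cardSuc natLeq - Id)" using cord_Well_order by (simp add: well_order_on_def)
  then have "wf (inv_image (cardSuc natLeq - Id) Rep_cord)" by (rule wf_inv_image)
  moreover have "{(x, y). x < (y :: cord)} \<subseteq> inv_image (cardSuc natLeq - Id) Rep_cord"
    by (auto simp: less_cord_def less_eq_cord_def Rep_cord_inject)
  ultimately have "wf {(x, y). x < (y :: cord)}" by (rule wf_subset)
  then show "P a" by (induction a rule: wf_induct_rule) (auto intro: step)
qed

lemma countable_lessThan_cord: "countable {..<a :: cord}"
proof -
  have "Rep_cord ` {..<a} \<subseteq> underS (cardSuc natLeq) (Rep_cord a)"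
    by (auto simp: underS_def less_cord_def less_eq_cord_def Rep_cord_inject)
  then have "|Rep_cord ` {..<a}| \<le>o |underS (cardSuc natLeq) (Rep_cord a)|" by (rule card_of_mono1)
  also have "|underS (cardSuc natLeq) (Rep_cord a)| <o cardSuc natLeq"
    by (rule card_of_underS[OF cardSuc_Card_order[OF natLeq_Card_order] Rep_cord])
  finally have "|Rep_cord ` {..<a}| \<le>o natLeq"
    using cardSuc_ordLeq_ordLess[OF natLeq_Card_order card_of_Card_order] by blast
  then have "countable (Rep_cord ` {..<a})" by (simp add: countable_card_le_natLeq)
  then show ?thesis
    by (rule countable_image_inj_on) (auto intro: inj_onI simp: Rep_cord_inject)
qed

lemma uncountable_cord: "\<not> countable (UNIV :: cord set)"
proof
  assume "countable (UNIV :: cord set)"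
  then have "countable (range Rep_cord)" by simp
  then have "countable (Field (cardSuc natLeq))"
    using type_definition.Rep_range[OF type_definition_cord] by simp
  then have "|Field (cardSuc natLeq)| \<le>o natLeq" by (simp add: countable_card_le_natLeq)
  then have "cardSuc natLeq \<le>o natLeq"
    using card_of_Field_ordIso[OF cardSuc_Card_order[OF natLeq_Card_order]]
      ordIso_symmetric ordIso_ordLeq_trans by blast
  then show False
    using cardSuc_greater[OF natLeq_Card_order] not_ordLess_ordLeq by blast
qed

lemma countable_bounded_cord:
  assumes "countable (A :: cord set)"
  shows "\<exists>b. \<forall>a\<in>A. a < b"
proof -
  have "countable {..a}" for a :: cord
    using countable_insert[OF countable_lessThan_cord[of a], of a]
    by (rule countable_subset[rotated]) auto
  then have "countable (\<Union>a\<in>A. {..a})" using assms by blast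
  then obtain b where "b \<notin> (\<Union>a\<in>A. {..a})" using uncountable_cord by (metis UNIV_eq_I)
  then show ?thesis by (auto simp: not_le)
qed

lemma Well_order_ordIso_cord:
  assumes r: "Well_order r" and "countable (Field r)"
  shows "\<exists>\<alpha> :: cord. r =o {(x, y). x \<le> y \<and> y < \<alpha>}"
proof -
  let ?R = "{(x, y). x \<le> (y :: cord)}"
  have F: "Field ?R = UNIV" by (auto simp: Field_def)
  have "wf (?R - Id)"
    using wf by (rule wf_subset) auto
  then have R: "Well_order ?R"
    unfolding order_on_defs F by (auto simp: refl_on_def trans_def antisym_def total_on_def)
  have "\<not> ?R \<le>o r"
  proof
    assume "?R \<le>o r"
    then have "|Field ?R| \<le>o |Field r|" by (rule card_of_mono2)
    then show False
      using assms(2) uncountable_cord unfolding F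
      by (meson countable_card_le_natLeq ordLeq_transitive)
  qed
  then have "r <o ?R" using r R by (simp add: not_ordLeq_iff_ordLess)
  then obtain \<alpha> where "r =o Restr ?R (underS ?R \<alpha>)"
    using ordLess_iff_ordIso_Restr[OF R r] by blast
  moreover have "Restr ?R (underS ?R \<alpha>) = {(x, y). x \<le> y \<and> y < \<alpha>}"
    by (auto simp: underS_def)
  ultimately show ?thesis by auto
qed

lemma LeastI_cord:
  assumes "countable A" "\<And>c :: cord. \<forall>a\<in>A. a < c \<Longrightarrow> P c"
  shows "P (LEAST c. P c)"
  using countable_bounded_cord[OF assms(1)] assms(2) by (metis LeastI)

text \<open>Ordinal sums and products, by transfinite recursion on the right argument; \<open>a * b\<close> is \<open>b\<close> copies of \<open>a\<close>.\<close>

instantiation cord :: "{zero, one}"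
begin
definition "0 = (LEAST c :: cord. True)"
definition "1 = (LEAST c :: cord. 0 < c)"
instance ..
end

function ord_add :: "cord \<Rightarrow> cord \<Rightarrow> cord" where
  "ord_add a b = (LEAST c. a \<le> c \<and> (\<forall>b'\<in>{..<b}. ord_add a b' < c))"
  by auto
termination by (relation "inv_image {(x, y). x < y} snd") (auto intro: wf)

declare ord_add.simps [simp del]

instantiation cord :: "{plus, minus}"
begin
definition "a + b = ord_add a b"
definition "c - a = (THE b :: cord. a + b = c)"  \<comment> \<open>left subtraction, meaningful for \<open>a \<le> c\<close>\<close>
instance ..
end

function ord_mult :: "cord \<Rightarrow> cord \<Rightarrow> cord" where
  "ord_mult a b = (LEAST c. \<forall>b'\<in>{..<b}. ord_mult a b' + a \<le> c)"
  by auto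
termination by (relation "inv_image {(x, y). x < y} snd") (auto intro: wf)

declare ord_mult.simps [simp del]

instantiation cord :: times
begin
definition "a * b = ord_mult a b"
instance ..
end

definition omega :: cord (\<open>\<omega>\<close>) where
  "\<omega> = (LEAST c. 0 < c \<and> (\<forall>b<c. b + 1 < c))"

definition ord_mod :: "cord \<Rightarrow> cord \<Rightarrow> cord" (infixl \<open>omod\<close> 70) where
  "c omod a = (THE \<rho>. \<rho> < a \<and> (\<exists>\<delta>. c = a * \<delta> + \<rho>))"

lemma zero_le_cord [simp]: "0 \<le> (a :: cord)"
  unfolding zero_cord_def by (rule Least_le) simp

lemma not_less_zero_cord [simp]: "\<not> a < (0 :: cord)"
  by (simp add: not_less)

lemma cord_add_unfold: "a + b = (LEAST c :: cord. a \<le> c \<and> (\<forall>b'<b. a + b' < c))"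
  by (subst plus_cord_def, subst ord_add.simps) (simp add: plus_cord_def Ball_def)

lemma cord_add_bounds: "a \<le> a + b \<and> (\<forall>b'<b. a + b' < a + (b :: cord))"
  unfolding cord_add_unfold[of a b]
  by (rule LeastI_cord[where A = "insert a ((+) a ` {..<b})"]) (auto intro: countable_lessThan_cord)

lemma cord_add_least: "a \<le> c \<Longrightarrow> (\<And>b'. b' < b \<Longrightarrow> a + b' < c) \<Longrightarrow> a + b \<le> (c :: cord)"
  unfolding cord_add_unfold[of a b] by (rule Least_le) simp

lemma cord_le_add: "a \<le> a + (b :: cord)"
  using cord_add_bounds by blast

lemma cord_add_less_cancel [simp]: "a + b < a + c \<longleftrightarrow> b < (c :: cord)"
  using cord_add_bounds[of a b] cord_add_bounds[of a c] by (metis less_asym linorder_neqE)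

lemma cord_add_cancel [simp]: "a + b = a + c \<longleftrightarrow> b = (c :: cord)"
  by (metis cord_add_less_cancel linorder_neqE less_irrefl)

lemma cord_add_0_right [simp]: "a + 0 = (a :: cord)"
  by (intro antisym cord_add_least cord_le_add) auto

lemma cord_add_ge_right: "b \<le> a + (b :: cord)"
proof (induction b rule: less_induct)
  case (less b)
  then show ?case by (meson cord_add_less_cancel not_le order_le_less_trans)
qed

lemma cord_le_imp_ex1_add:
  assumes "a \<le> (c :: cord)"
  shows "\<exists>!b. a + b = c"
proof -
  define b where "b = (LEAST b. c \<le> a + b)"
  have "c \<le> a + b" unfolding b_def using cord_add_ge_right by (rule LeastI)
  moreover have "a + b' < c" if "b' < b" for b'
    using not_less_Least[OF that[unfolded b_def]] by simp
  ultimately have "a + b = c" using assms cord_add_least by (intro antisym) blast+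
  then show ?thesis by (metis cord_add_cancel)
qed

lemma cord_add_diff_inverse: "a \<le> c \<Longrightarrow> a + (c - a) = (c :: cord)"
  unfolding minus_cord_def by (rule theI'[OF cord_le_imp_ex1_add])

lemma cord_mult_unfold: "a * b = (LEAST c :: cord. \<forall>b'<b. a * b' + a \<le> c)"
  by (subst times_cord_def, subst ord_mult.simps) (simp add: times_cord_def Ball_def)

lemma cord_mult_bounds: "b' < b \<Longrightarrow> a * b' + a \<le> a * (b :: cord)"
proof -
  have "\<forall>b'<b. a * b' + a \<le> a * b"
    unfolding cord_mult_unfold[of a b]
    by (rule LeastI_cord[where A = "(\<lambda>b'. a * b' + a) ` {..<b}"])
      (auto intro: countable_lessThan_cord less_imp_le)
  then show "b' < b \<Longrightarrow> a * b' + a \<le> a * b" by blast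
qed

lemma cord_mult_least: "(\<And>b'. b' < b \<Longrightarrow> a * b' + a \<le> c) \<Longrightarrow> a * b \<le> (c :: cord)"
  unfolding cord_mult_unfold[of a b] by (rule Least_le) simp

lemma cord_mult_strict_mono:
  assumes "0 < a" "b' < (b :: cord)"
  shows "a * b' < a * b"
  using cord_mult_bounds[OF assms(2), of a] assms(1)
  by (metis cord_add_0_right cord_add_less_cancel less_le_trans)

lemma cord_ex1_mod:
  assumes "0 < (a :: cord)"
  shows "\<exists>!\<rho>. \<rho> < a \<and> (\<exists>\<delta>. c = a * \<delta> + \<rho>)"
proof -
  have ge: "b \<le> a * b" for b
  proof (induction b rule: less_induct)
    case (less b)
    then show ?case by (meson assms cord_mult_strict_mono not_le order_le_less_trans)
  qed
  define d where "d = (LEAST d. c < a * d + a)"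
  have "c < a * c + a"
    using ge[of c] assms by (metis cord_add_0_right cord_add_less_cancel le_less_trans)
  then have 1: "c < a * d + a" unfolding d_def by (rule LeastI)
  have "a * d \<le> c"
    by (rule cord_mult_least) (use not_less_Least[of _ "\<lambda>d. c < a * d + a"] d_def in force)
  then obtain r where r: "c = a * d + r" using cord_le_imp_ex1_add by metis
  show ?thesis
  proof (intro ex1I[of _ r] conjI exI[of _ d])
    show "r < a" using 1 r by simp
    show "c = a * d + r" by (fact r)
    fix r' assume "r' < a \<and> (\<exists>d'. c = a * d' + r')"
    then obtain d' where r': "r' < a" "c = a * d' + r'" by blast
    have *: "a * x + s < a * y + t" if "x < y" "s < a" for x y s t
      using cord_mult_bounds[OF that(1), of a] that(2) cord_le_add[of "a * y" t]
      by (metis cord_add_less_cancel less_le_trans)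
    have "d = d'" using *[of d d' r r'] *[of d' d r' r] r r' \<open>r < a\<close> by (metis less_irrefl linorder_neqE)
    then show "r' = r" using r r' by simp
  qed
qed

lemma cord_zero_less_one [simp]: "(0 :: cord) < 1"
proof -
  obtain x :: cord where "0 < x" using countable_bounded_cord[of "{0}"] by auto
  then show ?thesis unfolding one_cord_def by (rule LeastI)
qed

lemma cord_less_add_one_iff: "b < a + 1 \<longleftrightarrow> b \<le> (a :: cord)"
proof
  assume "b \<le> a"
  moreover have "a + 0 < a + 1" by (simp only: cord_add_less_cancel cord_zero_less_one)
  ultimately show "b < a + 1" by simp
next
  assume b: "b < a + 1"
  have 0: "x = 0" if "x < 1" for x :: cord
    using not_less_Least[OF that[unfolded one_cord_def]] zero_le_cord[of x] by simp
  show "b \<le> a"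
  proof (rule ccontr)
    assume "\<not> b \<le> a"
    then have ab: "a < b" by simp
    then obtain x where "a + x = b" using cord_le_imp_ex1_add less_imp_le by blast
    with b have "x < 1" by auto
    then show False using 0[of x] \<open>a + x = b\<close> ab by simp
  qed
qed

lemma cord_add_one_mono: "b \<le> a \<Longrightarrow> b + 1 \<le> (a :: cord) + 1"
  by (meson cord_less_add_one_iff not_le order.strict_trans2 order_refl)

lemma less_omega_iff: "a < \<omega> \<longleftrightarrow> (\<exists>n. a = ((\<lambda>b. b + 1) ^^ n) 0)"
proof -
  let ?N = "\<lambda>n. ((\<lambda>b :: cord. b + 1) ^^ n) 0"
  have om: "0 < \<omega> \<and> (\<forall>b<\<omega>. b + 1 < \<omega>)"
  proof -
    obtain u where u: "\<forall>a\<in>range ?N. a < u" using countable_bounded_cord[of "range ?N"] by auto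
    define v where "v = (LEAST v. \<forall>n. ?N n < v)"
    have v: "\<forall>n. ?N n < v" unfolding v_def by (rule LeastI[of _ u]) (use u in auto)
    have "b + 1 < v" if "b < v" for b
    proof -
      from not_less_Least[OF that[unfolded v_def]] obtain n where "b \<le> ?N n" by (auto simp: not_less)
      then have "b + 1 \<le> ?N n + 1"
        by (rule cord_add_one_mono)
      also have "\<dots> = ?N (Suc n)" by simp
      also have "\<dots> < v" using v by (rule spec)
      finally show ?thesis .
    qed
    then show ?thesis unfolding omega_def by (rule_tac LeastI[of _ v]) (use v[rule_format, of 0] in auto)
  qed
  have "\<exists>n. a = ?N n" if a: "a < \<omega>"
  proof (rule ccontr)
    assume no: "\<nexists>n. a = ?N n"
    have N: "?N n < a" for n
    proof (induction n)
      case 0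
      have "a \<noteq> 0" using no by (metis funpow_0)
      then show ?case using zero_le_cord[of a] by (simp add: le_less)
    next
      case (Suc n)
      then have "\<not> a < ?N (Suc n)" by (simp add: cord_less_add_one_iff)
      moreover have "a \<noteq> ?N (Suc n)" using no by blast
      ultimately show ?case by (meson linorder_neqE)
    qed
    define v where "v = (LEAST v. \<forall>n. ?N n < v)"
    have v: "\<forall>n. ?N n < v" unfolding v_def by (rule LeastI[of _ a]) (use N in blast)
    have "v \<le> a" unfolding v_def by (rule Least_le) (use N in blast)
    moreover have "b + 1 < v" if "b < v" for b
    proof -
      from not_less_Least[OF that[unfolded v_def]] obtain n where "b \<le> ?N n" by (auto simp: not_less)
      then have "b + 1 \<le> ?N n + 1"
        by (rule cord_add_one_mono)
      also have "\<dots> = ?N (Suc n)" by simp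
      also have "\<dots> < v" using v by (rule spec)
      finally show ?thesis .
    qed
    ultimately have "\<omega> \<le> v"
      unfolding omega_def by (intro Least_le) (use v[rule_format, of 0] in auto)
    then show False using a \<open>v \<le> a\<close> by simp
  qed
  moreover have "?N n < \<omega>" for n using om by (induction n) auto
  ultimately show ?thesis by blast
qed

datatype 'p oword = OWord (len: cord) (letter: "cord \<Rightarrow> 'p set")

definition all_words :: "'p set \<Rightarrow> 'p oword set" where
  "all_words AP = {w. letter w \<in> {..<len w} \<rightarrow>\<^sub>E Pow AP}"

definition suffix :: "'p oword \<Rightarrow> cord \<Rightarrow> 'p oword" where
  "suffix w \<beta> = OWord (len w - \<beta>) (\<lambda>\<gamma>\<in>{..<len w - \<beta>}. letter w (\<beta> + \<gamma>))"

definition concat_word :: "'p oword \<Rightarrow> 'p oword \<Rightarrow> 'p oword" where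
  "concat_word u v = OWord (len u + len v)
     (\<lambda>\<gamma>\<in>{..<len u + len v}. if \<gamma> < len u then letter u \<gamma> else letter v (\<gamma> - len u))"

definition omega_power :: "'p oword \<Rightarrow> 'p oword" where
  "omega_power u = OWord (len u * \<omega>) (\<lambda>\<gamma>\<in>{..<len u * \<omega>}. letter u (\<gamma> omod len u))"

datatype 'l word_expr = Letter 'l | Concat "'l word_expr" "'l word_expr" | Omega "'l word_expr"

primrec denot :: "'p set word_expr \<Rightarrow> 'p oword" where
  "denot (Letter \<sigma>) = OWord 1 (\<lambda>\<gamma>\<in>{..<1}. \<sigma>)"
| "denot (Concat A B) = concat_word (denot A) (denot B)"
| "denot (Omega A) = omega_power (denot A)"

text \<open>\<open>set_word_expr A\<close> is the set of letters that occur in \<open>A\<close>.\<close>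

definition finitely_presentable :: "'p set \<Rightarrow> 'p oword \<Rightarrow> bool" where
  "finitely_presentable AP w \<longleftrightarrow> (\<exists>A. set_word_expr A \<subseteq> Pow AP \<and> denot A = w)"

lemma suffix_in_all_words:
  assumes "w \<in> all_words AP" "\<beta> < len w"
  shows "suffix w \<beta> \<in> all_words AP"
proof -
  have "\<beta> + \<gamma> < len w" if "\<gamma> < len w - \<beta>" for \<gamma>
    using that assms(2) by (metis cord_add_diff_inverse cord_add_less_cancel less_imp_le)
  then show ?thesis using assms(1) by (auto simp: all_words_def suffix_def)
qed

lemma denot_in_all_words:
  "set_word_expr A \<subseteq> Pow AP \<Longrightarrow> 0 < len (denot A) \<and> denot A \<in> all_words AP"
proof (induction A)
  case (Letter \<sigma>)
  then show ?case by (auto simp: all_words_def)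
next
  case (Concat A B)
  let ?a = "denot A" and ?b = "denot B"
  have A: "0 < len ?a" "letter ?a \<in> {..<len ?a} \<rightarrow>\<^sub>E Pow AP"
    and B: "letter ?b \<in> {..<len ?b} \<rightarrow>\<^sub>E Pow AP"
    using Concat by (simp_all add: all_words_def)
  have "\<gamma> - len ?a < len ?b" if "\<gamma> < len ?a + len ?b" "\<not> \<gamma> < len ?a" for \<gamma>
    using that by (metis cord_add_diff_inverse cord_add_less_cancel not_less)
  then have "letter ?b (\<gamma> - len ?a) \<in> Pow AP"
    if "\<gamma> < len ?a + len ?b" "\<not> \<gamma> < len ?a" for \<gamma>
    using that by (intro PiE_mem[OF B]) simp
  moreover have "letter ?a \<gamma> \<in> Pow AP" if "\<gamma> < len ?a" for \<gamma>
    using that by (intro PiE_mem[OF A(2)]) simp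
  ultimately have "concat_word ?a ?b \<in> all_words AP"
    unfolding all_words_def concat_word_def by (simp add: restrict_PiE_iff)
  moreover have "0 < len ?a + len ?b"
    using A(1) cord_le_add by (rule less_le_trans)
  ultimately show ?case by (simp add: concat_word_def)
next
  case (Omega A)
  let ?a = "denot A"
  have pos: "0 < len ?a" and w: "letter ?a \<in> {..<len ?a} \<rightarrow>\<^sub>E Pow AP"
    using Omega by (simp_all add: all_words_def)
  have "\<gamma> omod len ?a < len ?a" for \<gamma>
    using theI'[OF cord_ex1_mod[OF pos, of \<gamma>]] by (simp add: ord_mod_def)
  then have "letter ?a (\<gamma> omod len ?a) \<in> Pow AP" for \<gamma>
    by (intro PiE_mem[OF w]) simp
  then have "omega_power ?a \<in> all_words AP"
    unfolding all_words_def omega_power_def by (simp add: restrict_PiE_iff)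
  moreover have "0 < \<omega>" using less_omega_iff[of 0] funpow_0 by metis
  then have "0 < len ?a * \<omega>"
    using cord_mult_strict_mono[OF pos] zero_le_cord by (rule_tac le_less_trans)
  ultimately show ?case by (simp add: omega_power_def)
qed

datatype 'p ltl = Top | Bot | Prop 'p | And "'p ltl" "'p ltl" | Or "'p ltl" "'p ltl"
  | Next "'p ltl" | Fut "'p ltl"

text \<open>
  The word of length \<open>0\<close> has no letter \<open>w[0]\<close>; it is taken to satisfy no proposition.
\<close>

primrec sat :: "'p ltl \<Rightarrow> 'p oword \<Rightarrow> bool" where
  "sat Top w \<longleftrightarrow> True"
| "sat Bot w \<longleftrightarrow> False"
| "sat (Prop p) w \<longleftrightarrow> 0 < len w \<and> p \<in> letter w 0"
| "sat (And \<phi> \<psi>) w \<longleftrightarrow> sat \<phi> w \<and> sat \<psi> w"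
| "sat (Or \<phi> \<psi>) w \<longleftrightarrow> sat \<phi> w \<or> sat \<psi> w"
| "sat (Next \<phi>) w \<longleftrightarrow> 1 < len w \<and> sat \<phi> (suffix w 1)"
| "sat (Fut \<phi>) w \<longleftrightarrow> (\<exists>\<alpha><len w. sat \<phi> (suffix w \<alpha>))"

abbreviation Fhat :: "'p ltl \<Rightarrow> 'p ltl" where
  "Fhat \<phi> \<equiv> Next (Fut \<phi>)"

inductive_set ltl_Fhat :: "'p set \<Rightarrow> 'p ltl set" for AP :: "'p set" where
  "Top \<in> ltl_Fhat AP"
| "Bot \<in> ltl_Fhat AP"
| "p \<in> AP \<Longrightarrow> Prop p \<in> ltl_Fhat AP"
| "\<phi> \<in> ltl_Fhat AP \<Longrightarrow> \<psi> \<in> ltl_Fhat AP \<Longrightarrow> And \<phi> \<psi> \<in> ltl_Fhat AP"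
| "\<phi> \<in> ltl_Fhat AP \<Longrightarrow> \<psi> \<in> ltl_Fhat AP \<Longrightarrow> Or \<phi> \<psi> \<in> ltl_Fhat AP"
| "\<phi> \<in> ltl_Fhat AP \<Longrightarrow> Fhat \<phi> \<in> ltl_Fhat AP"

definition models :: "'p set \<Rightarrow> 'p ltl \<Rightarrow> 'p oword set" where
  "models AP \<phi> = {w \<in> all_words AP. sat \<phi> w}"

datatype sign = Pos | Neg

type_synonym 'p example = "'p oword \<times> sign"

definition fits :: "'p ltl \<Rightarrow> 'p example \<Rightarrow> bool" where
  "fits \<phi> e \<longleftrightarrow> (case e of (w, l) \<Rightarrow> (sat \<phi> w \<and> l = Pos) \<or> (\<not> sat \<phi> w \<and> l = Neg))"

definition uniquely_characterizes ::
    "'p set \<Rightarrow> 'p ltl set \<Rightarrow> 'p example set \<Rightarrow> 'p ltl \<Rightarrow> bool" where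
  "uniquely_characterizes AP L E \<phi> \<longleftrightarrow>
     (\<forall>e\<in>E. fits \<phi> e) \<and>
     (\<forall>\<psi>\<in>L. (\<forall>e\<in>E. fits \<psi> e) \<longrightarrow> models AP \<psi> = models AP \<phi>)"

definition admits_finite_characterizations :: "'p set \<Rightarrow> 'p ltl set \<Rightarrow> bool" where
  "admits_finite_characterizations AP L \<longleftrightarrow>
     (\<forall>\<phi>\<in>L. \<exists>E. finite E \<and> E \<subseteq> all_words AP \<times> UNIV \<and> uniquely_characterizes AP L E \<phi>)"

end

theory Submission
  imports "HOL-Library.Sublist" Defs
begin

text \<open>
  Every formula of the fragment is equivalent to a finite disjunction of chains
  \<open>a\<^sub>0 \<and> X F (a\<^sub>1 \<and> X F (\<dots>))\<close> of sets of propositions, because a conjunction of two chains is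
  the disjunction of all ways to merge them.  Hence truth is preserved under the Higman embedding
  of words (with the first letter fixed), and every word that satisfies a formula embeds a finite
  word that satisfies it.  The chains of \<open>\<phi>\<close>, read as finite words, are the positive examples.

  For the negative ones, consider a finite word \<open>v\<close> that avoids a finite set \<open>U\<close> of chains.  The
  longest prefix of \<open>v\<close> whose letters contain no head of a chain in \<open>U\<close> is a word over some set
  \<open>C\<close> of letters, and the first letter \<open>b\<close> outside \<open>C\<close> shortens at least one chain of \<open>U\<close>.
  So \<open>v\<close> embeds in \<open>C\<^sup>\<omega>\<close> or in a word \<open>C\<^sup>\<omega> b n\<close>, where \<open>n\<close> is taken from the finite set of words
  obtained by induction for the shortened chains; these words avoid \<open>U\<close> as well.
\<close>

section \<open>Ordinal arithmetic\<close>

lemma cord_zero_add: "0 + a = (a :: cord)"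
proof (induction a rule: less_induct)
  case (less a)
  then have "0 + a \<le> a" by (intro cord_add_least) auto
  then show ?case using cord_add_ge_right by (rule antisym)
qed

lemma cord_pos_iff: "0 < a \<longleftrightarrow> a \<noteq> (0 :: cord)"
  using zero_le_cord[of a] by (metis le_less not_less_zero_cord)

lemma cord_one_le_iff: "1 \<le> a \<longleftrightarrow> 0 < (a :: cord)"
  by (metis cord_less_add_one_iff cord_zero_add not_le)

text \<open>Sums are least bounds on either side. For the harder inequality, an ordinal below
  \<open>b + c\<close> is either below \<open>b\<close> or of the form \<open>b + d\<close> with
  \<open>d < c\<close>, where the induction applies.\<close>

lemma cord_add_assoc: "a + b + c = a + (b + c :: cord)"
proof (induction c rule: less_induct)
  case (less c)
  show ?case
  proof (rule antisym)
    have "a + b \<le> a + (b + c)"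
      using cord_le_add[of b c] by (metis cord_add_less_cancel not_le)
    then show "a + b + c \<le> a + (b + c)"
      by (rule cord_add_least) (simp add: less cord_add_less_cancel[of b])
    have "a + x < a + b + c" if "x < b + c" for x
    proof (cases "x < b")
      case True
      then have "a + x < a + b" by simp
      then show ?thesis using cord_le_add less_le_trans by blast
    next
      case False
      then obtain d where "x = b + d" by (metis cord_add_diff_inverse not_less)
      with that less[of d] show ?thesis by (metis cord_add_less_cancel)
    qed
    then show "a + (b + c) \<le> a + b + c"
      using cord_le_add[of a b] cord_le_add[of "a + b" c] order_trans
      by (intro cord_add_least) blast+
  qed
qed

lemma cord_add_right_mono: "a \<le> b \<Longrightarrow> a + c \<le> b + (c :: cord)"
proof (induction c rule: less_induct)
  case (less c)
  show ?case
  proof (rule cord_add_least)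
    show "a \<le> b + c" using less.prems cord_le_add order_trans by blast
    show "a + c' < b + c" if "c' < c" for c'
      using less.IH[OF that less.prems] that by (metis cord_add_less_cancel le_less_trans)
  qed
qed

lemma cord_add_left_mono: "b \<le> c \<Longrightarrow> a + b \<le> a + (c :: cord)"
  by (metis cord_add_less_cancel not_le)

lemma cord_mult_add_one: "a * (b + 1) = a * b + (a :: cord)"
proof (rule antisym)
  have "a * b' \<le> a * b" if "b' \<le> b" for b'
    using that by (metis cord_mult_bounds cord_le_add le_less order_trans)
  then have "a * b' + a \<le> a * b + a" if "b' < b + 1" for b'
    using that by (simp add: cord_add_right_mono cord_less_add_one_iff)
  then show "a * (b + 1) \<le> a * b + a" by (rule cord_mult_least)
  show "a * b + a \<le> a * (b + 1)"
    by (rule cord_mult_bounds) (simp add: cord_less_add_one_iff)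
qed

lemma zero_less_omega: "0 < \<omega>"
  using less_omega_iff[of 0] funpow_0 by metis

lemma less_omega_induct [consumes 1, case_names zero add_one]:
  assumes "a < \<omega>" "P 0" "\<And>b. b < \<omega> \<Longrightarrow> P b \<Longrightarrow> P (b + 1)"
  shows "P a"
proof -
  have "P (((\<lambda>b. b + 1) ^^ n) 0)" for n
  proof (induction n)
    case (Suc n)
    then show ?case using assms(3) less_omega_iff by auto
  qed (simp add: assms(2))
  then show ?thesis using assms(1) less_omega_iff by auto
qed

section \<open>Finite ordinals and absorption below \<open>\<omega> * \<omega>\<close>\<close>

lemma add_one_less_omega: "a < \<omega> \<Longrightarrow> a + 1 < \<omega>"
  unfolding less_omega_iff by (metis funpow.simps(2) comp_apply)

lemma one_less_omega: "1 < \<omega>"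
  using add_one_less_omega[OF zero_less_omega] by (simp add: cord_zero_add)

lemma add_less_omega:
  assumes "a < \<omega>" "b < \<omega>"
  shows "a + b < \<omega>"
  using assms(2,1) by (induction b rule: less_omega_induct)
    (auto simp: cord_add_assoc[symmetric] add_one_less_omega)

lemma mult_zero_cord: "a * 0 = (0 :: cord)"
  using cord_mult_least[of 0 a 0] zero_le_cord[of "a * 0"] by simp

lemma cord_mult_one: "a * 1 = (a :: cord)"
  using cord_mult_add_one[of a 0] by (simp add: mult_zero_cord cord_zero_add)

lemma mult_less_omega:
  assumes "a < \<omega>" "b < \<omega>"
  shows "a * b < \<omega>"
  using assms(2,1) by (induction b rule: less_omega_induct)
    (simp_all add: mult_zero_cord zero_less_omega cord_mult_add_one add_less_omega)

lemma finite_mult_omega_le: "a < \<omega> \<Longrightarrow> a * \<omega> \<le> \<omega>"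
  by (rule cord_mult_least) (simp add: add_less_omega mult_less_omega less_imp_le)

lemma omega_add_mult_le:
  assumes "k < \<omega>"
  shows "\<omega> + \<omega> * k \<le> \<omega> * (k + 1)"
  using assms
proof (induction k rule: less_omega_induct)
  case zero
  then show ?case by (simp add: mult_zero_cord cord_mult_one cord_zero_add)
next
  case (add_one k)
  then show ?case
    by (simp add: cord_mult_add_one cord_add_assoc[symmetric] cord_add_right_mono)
qed

text \<open>An ordinal below \<open>\<omega> * \<omega>\<close> lies below some
  \<open>\<omega> * k + \<omega>\<close> with finite \<open>k\<close>, so a further \<omega> on the
  left stays within finitely many copies. This lets words be prefixed with infinite blocks without
  leaving the bound.\<close>

lemma omega_add_less_omega_squared:
  assumes "a < \<omega> * \<omega>"
  shows "\<omega> + a < \<omega> * \<omega>"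
proof -
  obtain k where k: "k < \<omega>" "a < \<omega> * k + \<omega>"
    using assms cord_mult_least[of \<omega> \<omega> a] by (metis not_le)
  then have "\<omega> + a \<le> \<omega> + \<omega> * (k + 1)"
    by (intro cord_add_left_mono) (simp add: cord_mult_add_one)
  also have "\<dots> \<le> \<omega> * (k + 1 + 1)"
    by (simp add: omega_add_mult_le add_one_less_omega k)
  also have "\<dots> < \<omega> * \<omega>"
    by (simp add: cord_mult_strict_mono zero_less_omega add_one_less_omega k)
  finally show ?thesis .
qed

lemma omega_less_omega_squared: "\<omega> < \<omega> * \<omega>"
  using cord_mult_strict_mono[OF zero_less_omega one_less_omega] by (simp add: cord_mult_one)

lemma one_add_less_omega_squared: "a < \<omega> * \<omega> \<Longrightarrow> 1 + a < \<omega> * \<omega>"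
  using omega_add_less_omega_squared cord_add_right_mono[of 1 \<omega> a] one_less_omega
  by (meson le_less_trans less_imp_le)

section \<open>Chains in words\<close>

text \<open>The strict \<open>\<beta> > \<alpha>\<close> mirrors the \<open>Next\<close> in
  \<open>Fhat\<close>. Started at \<open>0\<close>, the embedding cannot use the first letter, which
  \<open>chain\<close> therefore tests separately.\<close>

primrec emb_after :: "'p set list \<Rightarrow> 'p oword \<Rightarrow> cord \<Rightarrow> bool" where
  "emb_after [] w \<alpha> \<longleftrightarrow> True"
| "emb_after (a # us) w \<alpha> \<longleftrightarrow> (\<exists>\<beta>>\<alpha>. \<beta> < len w \<and> a \<subseteq> letter w \<beta> \<and> emb_after us w \<beta>)"

text \<open>The word of length \<open>0\<close> behaves like the one-letter word \<open>{}\<close>.\<close>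

definition first :: "'p oword \<Rightarrow> 'p set" where
  "first w = (if 0 < len w then letter w 0 else {})"

definition chain :: "'p set \<times> 'p set list \<Rightarrow> 'p oword \<Rightarrow> bool" where
  "chain u w \<longleftrightarrow> fst u \<subseteq> first w \<and> emb_after (snd u) w 0"

lemma emb_after_antimono: "emb_after us w \<beta> \<Longrightarrow> \<alpha> \<le> \<beta> \<Longrightarrow> emb_after us w \<alpha>"
  by (cases us) (auto intro: le_less_trans)

lemma emb_after_ConsD: "emb_after (a # us) w \<alpha> \<Longrightarrow> emb_after us w \<alpha>"
  by (auto intro: emb_after_antimono less_imp_le)

lemma emb_after_list_emb:
  "list_emb (\<subseteq>) us vs \<Longrightarrow> emb_after vs w \<alpha> \<Longrightarrow> emb_after us w \<alpha>"
proof (induction arbitrary: \<alpha> rule: list_emb.induct)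
  case (list_emb_Cons us vs a)
  then show ?case using emb_after_ConsD by blast
next
  case (list_emb_Cons2 a b us vs)
  then show ?case by (simp only: emb_after.simps) (meson order_trans)
qed simp

text \<open>The positions after \<open>d + \<alpha>\<close> are exactly the
  \<open>d + \<gamma>\<close> with \<open>\<gamma> > \<alpha>\<close>, and there \<open>w\<close>
  reads as \<open>v\<close>. Suffixes and the right factor of a concatenation are both
  instances.\<close>

lemma emb_after_shift:
  assumes "len w = d + len v" "\<And>\<gamma>. \<gamma> < len v \<Longrightarrow> letter w (d + \<gamma>) = letter v \<gamma>"
  shows "emb_after us w (d + \<alpha>) \<longleftrightarrow> emb_after us v \<alpha>"
proof (induction us arbitrary: \<alpha>)
  case (Cons a us)
  have *: "d + \<alpha> < \<beta> \<longleftrightarrow> (\<exists>\<gamma>>\<alpha>. \<beta> = d + \<gamma>)" for \<beta>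
    using cord_le_add[of d \<alpha>] cord_add_diff_inverse[of d \<beta>]
    by (metis cord_add_less_cancel le_less_trans less_imp_le)
  have "emb_after (a # us) w (d + \<alpha>) \<longleftrightarrow>
      (\<exists>\<gamma>>\<alpha>. d + \<gamma> < len w \<and> a \<subseteq> letter w (d + \<gamma>) \<and> emb_after us w (d + \<gamma>))"
    unfolding emb_after.simps * by auto
  also have "\<dots> \<longleftrightarrow> emb_after (a # us) v \<alpha>"
    using assms Cons by (simp cong: conj_cong)
  finally show ?case .
qed simp

section \<open>Embeddings into suffixes and concatenations\<close>

lemma less_len_suffix_iff: "d \<le> len w \<Longrightarrow> \<gamma> < len (suffix w d) \<longleftrightarrow> d + \<gamma> < len w"
  unfolding suffix_def by (metis cord_add_diff_inverse cord_add_less_cancel oword.sel(1))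

lemma letter_suffix: "\<gamma> < len (suffix w d) \<Longrightarrow> letter (suffix w d) \<gamma> = letter w (d + \<gamma>)"
  by (simp add: suffix_def)

lemma emb_after_suffix:
  "d \<le> len w \<Longrightarrow> emb_after us (suffix w d) \<alpha> \<longleftrightarrow> emb_after us w (d + \<alpha>)"
  by (rule emb_after_shift[symmetric])
    (simp_all add: letter_suffix, simp add: suffix_def cord_add_diff_inverse)

lemma len_concat_word [simp]: "len (concat_word u v) = len u + len v"
  by (simp add: concat_word_def)

lemma letter_concat_word_left: "\<gamma> < len u \<Longrightarrow> letter (concat_word u v) \<gamma> = letter u \<gamma>"
  using less_le_trans[OF _ cord_le_add] by (simp add: concat_word_def)

lemma letter_concat_word_right:
  assumes "\<gamma> < len v"
  shows "letter (concat_word u v) (len u + \<gamma>) = letter v \<gamma>"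
proof -
  have "len u + \<gamma> - len u = \<gamma>"
    using cord_add_diff_inverse[of "len u" "len u + \<gamma>"] cord_le_add by simp
  moreover have "\<not> len u + \<gamma> < len u"
    using cord_le_add by (simp add: not_less)
  ultimately show ?thesis using assms by (simp add: concat_word_def)
qed

lemma emb_after_concat_word:
  "emb_after us (concat_word u v) (len u + \<alpha>) \<longleftrightarrow> emb_after us v \<alpha>"
  by (rule emb_after_shift) (simp_all add: letter_concat_word_right)

text \<open>The letter matching \<open>a\<close> can only sit in \<open>v\<close>, either as its
  first letter or later. Position \<open>0\<close> of \<open>u\<close> is exempt from the hypothesis
  because the embedding starts strictly after it.\<close>

lemma emb_after_concat_wordD:
  assumes "emb_after (a # us) (concat_word u v) 0"
    "\<And>\<beta>. 0 < \<beta> \<Longrightarrow> \<beta> < len u \<Longrightarrow> \<not> a \<subseteq> letter u \<beta>"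
  shows "a \<subseteq> first v \<and> emb_after us v 0 \<or> emb_after (a # us) v 0"
proof -
  obtain \<beta> where \<beta>: "0 < \<beta>" "\<beta> < len u + len v" "a \<subseteq> letter (concat_word u v) \<beta>"
    "emb_after us (concat_word u v) \<beta>"
    using assms(1) by auto
  with assms(2) have "len u \<le> \<beta>"
    by (metis letter_concat_word_left not_le)
  then obtain \<gamma> where \<gamma>: "\<beta> = len u + \<gamma>"
    by (metis cord_add_diff_inverse)
  with \<beta> have "\<gamma> < len v" "a \<subseteq> letter v \<gamma>" "emb_after us v \<gamma>"
    by (auto simp: letter_concat_word_right emb_after_concat_word)
  then show ?thesis
    by (cases "\<gamma> = 0") (auto simp: first_def cord_pos_iff)
qed

text \<open>The first letter of \<open>v\<close>, out of reach inside \<open>v\<close>, becomes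
  available in the concatenation, at position \<open>len u > \<alpha>\<close>.\<close>

lemma emb_after_concat_wordI:
  assumes "a \<subseteq> first v" "emb_after us v 0" "0 < len v" "\<alpha> < len u"
  shows "emb_after (a # us) (concat_word u v) \<alpha>"
proof -
  have "len u < len u + len v"
    using assms(3) by (metis cord_add_0_right cord_add_less_cancel)
  moreover have "a \<subseteq> letter (concat_word u v) (len u)"
    using letter_concat_word_right[of 0 v u] assms(1,3) by (simp add: first_def)
  moreover have "emb_after us (concat_word u v) (len u)"
    using emb_after_concat_word[of us u v 0] assms(2) by simp
  ultimately show ?thesis using assms(4) by auto
qed

lemma first_concat_word: "0 < len u \<Longrightarrow> first (concat_word u v) = first u"
  using less_le_trans[OF _ cord_le_add] by (simp add: first_def letter_concat_word_left)

section \<open>Disjunctive normal form\<close>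

text \<open>Shuffles in which two letters may also share a position and then fuse to their union;
  they describe the conjunction of two embeddings.\<close>

fun merges :: "'p set list \<Rightarrow> 'p set list \<Rightarrow> 'p set list set" where
  "merges [] vs = {vs}"
| "merges us [] = {us}"
| "merges (a # us) (b # vs) =
     (#) a ` merges us (b # vs) \<union> (#) b ` merges (a # us) vs \<union> (#) (a \<union> b) ` merges us vs"

lemma finite_merges: "finite (merges us vs)"
  by (induction us vs rule: merges.induct) auto

lemma Union_set_merges: "xs \<in> merges us vs \<Longrightarrow> \<Union> (set xs) = \<Union> (set us) \<union> \<Union> (set vs)"
  by (induction us vs arbitrary: xs rule: merges.induct) fastforce+

lemma lists_Pow_iff: "xs \<in> lists (Pow A) \<longleftrightarrow> \<Union> (set xs) \<subseteq> A"
  by auto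

lemma merges_lists: "us \<in> lists (Pow A) \<Longrightarrow> vs \<in> lists (Pow A) \<Longrightarrow> merges us vs \<subseteq> lists (Pow A)"
  unfolding subset_iff[of "merges us vs"] lists_Pow_iff using Union_set_merges by (metis Un_least)

lemma emb_after_merges:
  "emb_after us w \<alpha> \<and> emb_after vs w \<alpha> \<longleftrightarrow> (\<exists>xs\<in>merges us vs. emb_after xs w \<alpha>)"
proof (induction us vs arbitrary: \<alpha> rule: merges.induct)
  case (3 a us b vs)
  have "emb_after (a # us) w \<alpha> \<and> emb_after (b # vs) w \<alpha> \<longleftrightarrow>
      (\<exists>\<beta>>\<alpha>. \<beta> < len w \<and> a \<subseteq> letter w \<beta> \<and> emb_after us w \<beta> \<and> emb_after (b # vs) w \<beta>) \<or>
      (\<exists>\<beta>>\<alpha>. \<beta> < len w \<and> b \<subseteq> letter w \<beta> \<and> emb_after (a # us) w \<beta> \<and> emb_after vs w \<beta>) \<or>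
      (\<exists>\<beta>>\<alpha>. \<beta> < len w \<and> a \<union> b \<subseteq> letter w \<beta> \<and> emb_after us w \<beta> \<and> emb_after vs w \<beta>)"
    (is "_ \<longleftrightarrow> ?A \<or> ?B \<or> ?C")
  proof
    assume "emb_after (a # us) w \<alpha> \<and> emb_after (b # vs) w \<alpha>"
    then obtain \<beta> \<gamma> where
      "\<beta> > \<alpha>" "\<beta> < len w" "a \<subseteq> letter w \<beta>" "emb_after us w \<beta>"
      "\<gamma> > \<alpha>" "\<gamma> < len w" "b \<subseteq> letter w \<gamma>" "emb_after vs w \<gamma>"
      by auto
    \<comment> \<open>The witnesses for the two heads are compared: the earlier one is split off,
      and a common one carries \<open>a \<union> b\<close>.\<close>
    then show "?A \<or> ?B \<or> ?C"
      by (cases \<beta> \<gamma> rule: linorder_cases) auto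
  next
    assume "?A \<or> ?B \<or> ?C"
    then show "emb_after (a # us) w \<alpha> \<and> emb_after (b # vs) w \<alpha>"
      by (elim disjE exE conjE) (auto intro: less_trans)
  qed
  also have "\<dots> \<longleftrightarrow> (\<exists>xs\<in>merges (a # us) (b # vs). emb_after xs w \<alpha>)"
    unfolding 3 merges.simps by (simp add: bex_Un) blast
  finally show ?case .
qed auto

text \<open>The nested suffixes are re-indexed by the absolute position
  \<open>\<beta> = 1 + \<alpha>\<close>, so that \<open>Fhat\<close> speaks about positions
  \<open>\<beta> > 0\<close> of \<open>w\<close> itself. Here \<open>\<beta> - 1\<close> is left
  subtraction, which leaves infinite \<beta> fixed.\<close>

lemma sat_Fhat_iff: "sat (Fhat \<phi>) w \<longleftrightarrow> (\<exists>\<beta>>0. \<beta> < len w \<and> sat \<phi> (suffix (suffix w 1) (\<beta> - 1)))"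
proof -
  have *: "1 + (\<beta> - 1) = \<beta>" if "0 < \<beta>" for \<beta> :: cord
    using that by (simp add: cord_add_diff_inverse cord_one_le_iff)
  have **: "1 + \<alpha> - 1 = \<alpha>" for \<alpha> :: cord
    using cord_add_diff_inverse[of 1 "1 + \<alpha>"] cord_le_add by simp
  have ***: "0 < 1 + \<alpha>" for \<alpha> :: cord
    using cord_le_add[of 1 \<alpha>] cord_one_le_iff by blast
  show ?thesis
  proof
    assume "sat (Fhat \<phi>) w"
    then obtain \<alpha> where "1 < len w" "\<alpha> < len (suffix w 1)" "sat \<phi> (suffix (suffix w 1) \<alpha>)" by auto
    then show "\<exists>\<beta>>0. \<beta> < len w \<and> sat \<phi> (suffix (suffix w 1) (\<beta> - 1))"
      by (intro exI[of _ "1 + \<alpha>"]) (simp add: ** *** less_len_suffix_iff)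
  next
    assume "\<exists>\<beta>>0. \<beta> < len w \<and> sat \<phi> (suffix (suffix w 1) (\<beta> - 1))"
    then obtain \<beta> where \<beta>: "0 < \<beta>" "\<beta> < len w" "sat \<phi> (suffix (suffix w 1) (\<beta> - 1))" by auto
    then have "1 < len w" using cord_one_le_iff le_less_trans by blast
    then show "sat (Fhat \<phi>) w"
      using \<beta> by (auto intro!: exI[of _ "\<beta> - 1"] simp: * less_len_suffix_iff)
  qed
qed

lemma chain_suffix_suffix:
  assumes "0 < \<beta>" "\<beta> < len w"
  shows "chain u (suffix (suffix w 1) (\<beta> - 1)) \<longleftrightarrow> fst u \<subseteq> letter w \<beta> \<and> emb_after (snd u) w \<beta>"
proof -
  let ?v = "suffix w 1" and ?d = "\<beta> - 1"
  have 1: "1 \<le> len w" using assms cord_one_le_iff less_trans by blast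
  have d: "1 + ?d = \<beta>"
    using assms by (simp add: cord_add_diff_inverse cord_one_le_iff)
  have v: "?d < len ?v" using 1 d assms by (simp add: less_len_suffix_iff)
  then have "0 < len (suffix ?v ?d)" by (simp add: less_len_suffix_iff)
  then have "first (suffix ?v ?d) = letter w \<beta>"
    using v d by (simp add: first_def letter_suffix)
  then show ?thesis
    using v 1 d by (simp add: chain_def emb_after_suffix)
qed

text \<open>The set \<open>P\<close> is read as a disjunction. The equivalence ranges over all
  words, the empty one included; there \<open>first\<close> agrees with the convention for
  \<open>Prop\<close>.\<close>

definition normal_form :: "'p set \<Rightarrow> 'p ltl \<Rightarrow> ('p set \<times> 'p set list) set \<Rightarrow> bool" where
  "normal_form AP \<phi> P \<longleftrightarrow> finite P \<and> P \<subseteq> Pow AP \<times> lists (Pow AP) \<and>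
     (\<forall>w. sat \<phi> w \<longleftrightarrow> (\<exists>u\<in>P. chain u w))"

text \<open>Both heads constrain the same position \<open>0\<close>, so they are joined by union;
  the tails can be interleaved in several ways and are merged.\<close>

lemma normal_form_And:
  assumes P: "normal_form AP \<phi> P" and Q: "normal_form AP \<psi> Q"
  shows "normal_form AP (And \<phi> \<psi>) (\<Union>(a, us)\<in>P. \<Union>(b, vs)\<in>Q. Pair (a \<union> b) ` merges us vs)"
    (is "normal_form _ _ ?R")
  unfolding normal_form_def
proof (intro conjI allI subsetI)
  show "finite ?R" using P Q by (auto simp: normal_form_def finite_merges)
next
  fix x assume "x \<in> ?R"
  then obtain a us b vs xs where x: "(a, us) \<in> P" "(b, vs) \<in> Q" "xs \<in> merges us vs" "x = (a \<union> b, xs)"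
    by auto
  then have "a \<subseteq> AP" "us \<in> lists (Pow AP)" "b \<subseteq> AP" "vs \<in> lists (Pow AP)"
    using P Q unfolding normal_form_def by blast+
  with x(3,4) merges_lists[of us AP vs] show "x \<in> Pow AP \<times> lists (Pow AP)" by blast
next
  fix w
  have "sat \<phi> w \<longleftrightarrow> (\<exists>u\<in>P. chain u w)" "sat \<psi> w \<longleftrightarrow> (\<exists>v\<in>Q. chain v w)"
    using P Q by (simp_all add: normal_form_def)
  then have "sat (And \<phi> \<psi>) w \<longleftrightarrow> (\<exists>u\<in>P. \<exists>v\<in>Q. chain u w \<and> chain v w)"
    by (simp only: sat.simps) blast
  also have "\<dots> \<longleftrightarrow> (\<exists>u\<in>P. \<exists>v\<in>Q. fst u \<union> fst v \<subseteq> first w \<and>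
      emb_after (snd u) w 0 \<and> emb_after (snd v) w 0)"
    by (simp add: chain_def conj_ac)
  also have "\<dots> \<longleftrightarrow> (\<exists>x\<in>?R. chain x w)"
    unfolding emb_after_merges by (simp add: chain_def split_beta)
  finally show "sat (And \<phi> \<psi>) w \<longleftrightarrow> (\<exists>x\<in>?R. chain x w)" .
qed

text \<open>The old head has to be found at a later position, so it moves into the tail; the new
  head \<open>{}\<close> leaves the first letter free.\<close>

lemma normal_form_Fhat:
  assumes P: "normal_form AP \<phi> P"
  shows "normal_form AP (Fhat \<phi>) ((\<lambda>u. ({}, fst u # snd u)) ` P)"
  unfolding normal_form_def
proof (intro conjI allI)
  fix w
  have "sat (Fhat \<phi>) w \<longleftrightarrow>
      (\<exists>\<beta>>0. \<beta> < len w \<and> (\<exists>u\<in>P. fst u \<subseteq> letter w \<beta> \<and> emb_after (snd u) w \<beta>))"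
    using P unfolding sat_Fhat_iff normal_form_def
    by (simp add: chain_suffix_suffix cong: conj_cong)
  also have "\<dots> \<longleftrightarrow> (\<exists>u\<in>P. emb_after (fst u # snd u) w 0)"
    by (simp only: emb_after.simps) blast
  finally show "sat (Fhat \<phi>) w \<longleftrightarrow> (\<exists>u\<in>(\<lambda>u. ({}, fst u # snd u)) ` P. chain u w)"
    by (simp add: chain_def)
next
  have "u \<in> Pow AP \<times> lists (Pow AP)" if "u \<in> P" for u
    using P that unfolding normal_form_def by blast
  then show "(\<lambda>u. ({}, fst u # snd u)) ` P \<subseteq> Pow AP \<times> lists (Pow AP)"
    by (simp add: image_subset_iff mem_Times_iff)
qed (use P in \<open>simp add: normal_form_def\<close>)

lemma ltl_Fhat_normal_form: "\<phi> \<in> ltl_Fhat AP \<Longrightarrow> \<exists>P. normal_form AP \<phi> P"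
proof (induction rule: ltl_Fhat.induct)
  case 1
  show ?case by (rule exI[of _ "{({}, [])}"]) (simp add: normal_form_def chain_def)
next
  case 2
  show ?case by (rule exI[of _ "{}"]) (simp add: normal_form_def)
next
  case (3 p)
  then show ?case
    by (intro exI[of _ "{({p}, [])}"]) (simp add: normal_form_def chain_def first_def)
next
  case (4 \<phi> \<psi>)
  then show ?case using normal_form_And by blast
next
  case (5 \<phi> \<psi>)
  then obtain P Q where "normal_form AP \<phi> P" "normal_form AP \<psi> Q" by blast
  then have "normal_form AP (Or \<phi> \<psi>) (P \<union> Q)"
    by (simp add: normal_form_def bex_Un)
  then show ?case ..
next
  case (6 \<phi>)
  then show ?case using normal_form_Fhat by blast
qed

section \<open>Finite words as positive examples\<close>

primrec finite_word :: "'p set \<Rightarrow> 'p set list \<Rightarrow> 'p set word_expr" where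
  "finite_word a [] = Letter a"
| "finite_word a (b # us) = Concat (Letter a) (finite_word b us)"

lemma set_finite_word: "set_word_expr (finite_word a us) = insert a (set us)"
  by (induction us arbitrary: a) auto

lemma len_finite_word: "0 < len (denot (finite_word a us)) \<and> len (denot (finite_word a us)) < \<omega>"
proof (induction us arbitrary: a)
  case (Cons b us)
  then show ?case
    using less_le_trans[OF cord_zero_less_one cord_le_add] by (simp add: add_less_omega one_less_omega)
qed (simp add: one_less_omega)

lemma first_finite_word: "first (denot (finite_word a us)) = a"
  by (cases us) (simp_all add: first_concat_word first_def letter_concat_word_left
      less_le_trans[OF cord_zero_less_one cord_le_add])

lemma no_pos_less_one: "0 < \<beta> \<Longrightarrow> \<not> \<beta> < (1 :: cord)"
  using cord_one_le_iff not_le by blast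

text \<open>The new letter occupies the unreachable position \<open>0\<close> and pushes the first
  letter of \<open>v\<close> to position \<open>1\<close>, where it can be used.\<close>

lemma emb_after_Letter_concat:
  assumes "0 < len v"
  shows "emb_after (c # us) (concat_word (denot (Letter a)) v) 0 \<longleftrightarrow>
    c \<subseteq> first v \<and> emb_after us v 0 \<or> emb_after (c # us) v 0"
proof
  assume "emb_after (c # us) (concat_word (denot (Letter a)) v) 0"
  then show "c \<subseteq> first v \<and> emb_after us v 0 \<or> emb_after (c # us) v 0"
    by (rule emb_after_concat_wordD) (simp add: no_pos_less_one)
next
  assume "c \<subseteq> first v \<and> emb_after us v 0 \<or> emb_after (c # us) v 0"
  then show "emb_after (c # us) (concat_word (denot (Letter a)) v) 0"
  proof
    assume "emb_after (c # us) v 0"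
    then have "emb_after (c # us) (concat_word (denot (Letter a)) v) (len (denot (Letter a)) + 0)"
      by (simp only: emb_after_concat_word)
    then show ?thesis by (rule emb_after_antimono) simp
  qed (use assms in \<open>auto intro!: emb_after_concat_wordI simp del: emb_after.simps\<close>)
qed

text \<open>This identifies \<open>emb_after\<close> with Higman embedding. The letter
  \<open>a\<close> at position \<open>0\<close> is invisible to it, so only \<open>us\<close>
  appears on the right, and the induction varies \<open>a\<close>.\<close>

lemma emb_after_finite_word:
  "emb_after vs (denot (finite_word a us)) 0 \<longleftrightarrow> list_emb (\<subseteq>) vs us"
proof (induction us arbitrary: a vs)
  case Nil
  show ?case by (cases vs) (auto simp: no_pos_less_one)
next
  case (Cons b us)
  show ?case
  proof (cases vs)
    case (Cons c cs)
    have "emb_after vs (denot (finite_word a (b # us))) 0 \<longleftrightarrow>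
        c \<subseteq> b \<and> list_emb (\<subseteq>) cs us \<or> list_emb (\<subseteq>) (c # cs) us"
      unfolding Cons finite_word.simps denot.simps(2)
      by (simp only: emb_after_Letter_concat len_finite_word first_finite_word Cons.IH)
    also have "\<dots> \<longleftrightarrow> list_emb (\<subseteq>) (c # cs) (b # us)"
      by (auto elim: list_emb.cases intro: list_emb.intros)
    finally show ?thesis using Cons by simp
  qed simp
qed

lemma chain_finite_word:
  "chain (b, vs) (denot (finite_word a us)) \<longleftrightarrow> b \<subseteq> a \<and> list_emb (\<subseteq>) vs us"
  by (simp add: chain_def first_finite_word emb_after_finite_word)

lemma chain_mono:
  "b \<subseteq> a \<Longrightarrow> list_emb (\<subseteq>) vs us \<Longrightarrow> chain (a, us) w \<Longrightarrow> chain (b, vs) w"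
  unfolding chain_def using emb_after_list_emb by auto

lemma letter_finite_word:
  assumes "c \<in> insert a (set us)"
  shows "\<exists>\<gamma> < len (denot (finite_word a us)). letter (denot (finite_word a us)) \<gamma> = c"
  using assms
proof (induction us arbitrary: a)
  case (Cons b us)
  let ?v = "denot (finite_word b us)"
  show ?case
  proof (cases "c = a")
    case True
    then show ?thesis
      using first_finite_word[of a "b # us"] len_finite_word[of a "b # us"]
      by (intro exI[of _ 0]) (simp add: first_def)
  next
    case False
    with Cons obtain \<gamma> where "\<gamma> < len ?v" "letter ?v \<gamma> = c" by auto
    then show ?thesis
      using letter_concat_word_right[of \<gamma> ?v "denot (Letter a)"]
      by (intro exI[of _ "1 + \<gamma>"]) simp
  qed
qed (auto intro: exI[of _ 0])

lemma letter_finite_word_in: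
  assumes "\<gamma> < len (denot (finite_word a us))"
  shows "letter (denot (finite_word a us)) \<gamma> \<in> insert a (set us)"
  using assms
proof (induction us arbitrary: a \<gamma>)
  case (Cons b us)
  show ?case
  proof (cases "\<gamma> < 1")
    case True
    then show ?thesis using letter_concat_word_left[of \<gamma> "denot (Letter a)"] by simp
  next
    case False
    then obtain \<delta> where "\<gamma> = 1 + \<delta>" by (metis cord_add_diff_inverse not_less)
    then show ?thesis
      using Cons letter_concat_word_right[of \<delta> "denot (finite_word b us)" "denot (Letter a)"]
      by auto
  qed
qed auto

section \<open>Maximal words avoiding finitely many chains\<close>

lemma omod_less: "0 < a \<Longrightarrow> c omod a < a"
  using theI'[OF cord_ex1_mod[of a c]] by (simp add: ord_mod_def)

lemma mult_add_omod:
  assumes "\<rho> < a"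
  shows "(a * \<delta> + \<rho>) omod a = \<rho>"
  unfolding ord_mod_def
  by (rule the1_equality[OF cord_ex1_mod]) (use assms in \<open>auto intro: le_less_trans[OF zero_le_cord]\<close>)

lemma letter_omega_power:
  "\<gamma> < len (omega_power u) \<Longrightarrow> letter (omega_power u) \<gamma> = letter u (\<gamma> omod len u)"
  by (simp add: omega_power_def)

text \<open>The position \<alpha> lies in or before copy \<delta> of \<open>u\<close>; the letter at
  offset \<rho> of copy \<open>\<delta> + 1\<close> comes later, and that copy exists because
  \<omega> is closed under successor.\<close>

lemma letter_omega_power_recurs:
  assumes "\<alpha> < len (omega_power u)" "\<rho> < len u"
  shows "\<exists>\<beta>>\<alpha>. \<beta> < len (omega_power u) \<and> letter (omega_power u) \<beta> = letter u \<rho>"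
proof -
  let ?a = "len u"
  have len: "len (omega_power u) = ?a * \<omega>" by (simp add: omega_power_def)
  obtain \<delta> where \<delta>: "\<delta> < \<omega>" "\<alpha> < ?a * \<delta> + ?a"
    using assms(1) cord_mult_least[of \<omega> ?a \<alpha>] unfolding len by (metis not_le)
  define \<beta> where "\<beta> = ?a * (\<delta> + 1) + \<rho>"
  have "\<alpha> < ?a * (\<delta> + 1)" using \<delta>(2) by (simp add: cord_mult_add_one)
  then have "\<alpha> < \<beta>" unfolding \<beta>_def using cord_le_add less_le_trans by blast
  moreover have "\<beta> < ?a * \<omega>"
    unfolding \<beta>_def using cord_mult_bounds[OF add_one_less_omega[OF \<delta>(1)], of ?a] assms(2)
    by (metis cord_add_less_cancel less_le_trans)
  moreover have "\<beta> omod ?a = \<rho>"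
    unfolding \<beta>_def using assms(2) by (rule mult_add_omod)
  ultimately show ?thesis using letter_omega_power len by metis
qed

text \<open>The word is \<open>\<sigma> C^\<omega>\<close>, or just \<sigma> for empty
  \<open>C\<close>: a list enumerating \<open>C\<close> is repeated. The letter \<sigma> stands in
  front as it need not belong to \<open>C\<close>; this gives the bound
  \<open>1 + \<omega>\<close>.\<close>

lemma repeating_word:
  assumes "finite C" "C \<subseteq> Pow AP" "\<sigma> \<subseteq> AP"
  obtains A where "set_word_expr A \<subseteq> Pow AP" "first (denot A) = \<sigma>" "0 < len (denot A)"
    "\<And>\<beta>. 0 < \<beta> \<Longrightarrow> \<beta> < len (denot A) \<Longrightarrow> letter (denot A) \<beta> \<in> C"
    "\<And>\<alpha> c. \<alpha> < len (denot A) \<Longrightarrow> c \<in> C \<Longrightarrow> \<exists>\<beta>>\<alpha>. \<beta> < len (denot A) \<and> letter (denot A) \<beta> = c"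
    "len (denot A) \<le> 1 + \<omega>"
proof (cases "C = {}")
  case True
  show thesis
  proof (rule that[of "Letter \<sigma>"])
    show "len (denot (Letter \<sigma>)) \<le> 1 + \<omega>" by (simp add: cord_le_add)
  qed (use assms True in \<open>auto simp: first_def no_pos_less_one\<close>)
next
  case False
  then obtain c cs where cs: "insert c (set cs) = C"
    using finite_list[OF assms(1)] by (metis list.simps(15) list.exhaust set_empty)
  define f where "f = denot (finite_word c cs)"
  define v where "v = omega_power f"
  define s where "s = denot (Letter \<sigma>)"
  have s: "len s = 1" "first s = \<sigma>" by (simp_all add: s_def first_def)
  have f: "0 < len f" "len f < \<omega>" using len_finite_word by (auto simp: f_def)
  have in_C: "letter v \<gamma> \<in> C" if "\<gamma> < len v" for \<gamma>
    using that letter_finite_word_in[of "\<gamma> omod len f" c cs] omod_less[OF f(1), of \<gamma>] cs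
    by (simp add: v_def letter_omega_power f_def)
  have rec: "\<exists>\<beta>>\<alpha>. \<beta> < len v \<and> letter v \<beta> = x" if "\<alpha> < len v" "x \<in> C" for \<alpha> x
    using that letter_finite_word[of x c cs] letter_omega_power_recurs[of \<alpha> f] cs
    unfolding v_def f_def by blast
  have lv: "0 < len v" "len v \<le> \<omega>"
    using finite_mult_omega_le[OF f(2)] cord_mult_strict_mono[OF f(1) zero_less_omega]
    by (auto simp: v_def omega_power_def mult_zero_cord)
  have d: "denot (Concat (Letter \<sigma>) (Omega (finite_word c cs))) = concat_word s v"
    by (simp add: s_def v_def f_def)
  have *: "\<exists>\<gamma>. \<beta> = len s + \<gamma>" if "0 < \<beta>" for \<beta>
    using that s(1) by (metis cord_add_diff_inverse cord_one_le_iff)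
  show thesis
  proof (rule that[of "Concat (Letter \<sigma>) (Omega (finite_word c cs))"]; (unfold d)?)
    show "set_word_expr (Concat (Letter \<sigma>) (Omega (finite_word c cs))) \<subseteq> Pow AP"
      using assms cs by (auto simp: set_finite_word)
    show "first (concat_word s v) = \<sigma>" using s by (simp add: first_concat_word)
    show "0 < len (concat_word s v)"
      using s(1) by (simp add: less_le_trans[OF cord_zero_less_one cord_le_add])
    show "letter (concat_word s v) \<beta> \<in> C" if "0 < \<beta>" "\<beta> < len (concat_word s v)" for \<beta>
      using *[OF that(1)] that(2) in_C by (auto simp: letter_concat_word_right)
    show "len (concat_word s v) \<le> 1 + \<omega>"
      using lv(2) s(1) by (simp add: cord_add_left_mono)
    show "\<exists>\<beta>>\<alpha>. \<beta> < len (concat_word s v) \<and> letter (concat_word s v) \<beta> = x"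
      if "\<alpha> < len (concat_word s v)" "x \<in> C" for \<alpha> x
    proof -
      \<comment> \<open>The start \<alpha> is moved into the periodic part: to its beginning for
        \<open>\<alpha> = 0\<close>, to the corresponding offset otherwise.\<close>
      obtain \<gamma> where \<gamma>: "\<gamma> < len v" "\<alpha> \<le> len s + \<gamma>"
      proof (cases "\<alpha> = 0")
        case True
        then show thesis using that[of 0] lv(1) by simp
      next
        case False
        then show thesis
          using that *[of \<alpha>] \<open>\<alpha> < len (concat_word s v)\<close> by (auto simp: cord_pos_iff)
      qed
      then obtain \<beta> where "\<beta> > \<gamma>" "\<beta> < len v" "letter v \<beta> = x"
        using rec \<open>x \<in> C\<close> by blast
      then show ?thesis
        using \<gamma> by (intro exI[of _ "len s + \<beta>"])
          (auto simp: letter_concat_word_right intro: le_less_trans)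
    qed
  qed
qed

section \<open>Greedy embedding and residual chains\<close>

lemma emb_after_append:
  assumes "\<And>\<alpha>. \<alpha> < m \<Longrightarrow> emb_after ys w \<alpha>" "m \<le> len w"
    "\<And>\<alpha> c. \<alpha> < m \<Longrightarrow> c \<in> C \<Longrightarrow> \<exists>\<beta>>\<alpha>. \<beta> < m \<and> letter w \<beta> = c"
  shows "xs \<in> lists C \<Longrightarrow> \<alpha> < m \<Longrightarrow> emb_after (xs @ ys) w \<alpha>"
proof (induction xs arbitrary: \<alpha>)
  case (Cons c xs)
  \<comment> \<open>Every letter of \<open>xs\<close> is found again below \<open>m\<close>, so the
    search never leaves that range before \<open>ys\<close> starts.\<close>
  then obtain \<beta> where "\<beta> > \<alpha>" "\<beta> < m" "letter w \<beta> = c"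
    using assms(3)[OF Cons.prems(2), of c] by auto
  with Cons assms(2) show ?case by (auto intro: less_le_trans)
qed (simp add: assms(1))

text \<open>What is left of the chain \<open>u\<close> after a greedy reading of the letter
  \<open>b\<close>: a list \<open>b # v\<close> avoids \<open>u\<close> only if \<open>v\<close>
  avoids \<open>residual b u\<close>.\<close>

definition residual :: "'p set \<Rightarrow> 'p set list \<Rightarrow> 'p set list" where
  "residual b u = (if u \<noteq> [] \<and> hd u \<subseteq> b then tl u else u)"

lemma length_residual_le: "length (residual b u) \<le> length u"
  by (simp add: residual_def)

lemma list_emb_residual:
  "list_emb (\<subseteq>) (residual b u) v \<Longrightarrow> list_emb (\<subseteq>) u (b # v)"
  by (cases u) (auto simp: residual_def split: if_splits)

text \<open>The words of \<open>N\<close> avoid \<open>U\<close> and dominate every list that avoids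
  it. The induction is on the total length of the chains; \<sigma> varies because the words for the
  residuals must begin with the letter \<open>b\<close> that ends the block over
  \<open>C\<close>.\<close>

lemma avoiding_words:
  fixes AP :: "'p set"
  assumes "finite AP" "finite U" "\<sigma> \<subseteq> AP"
  shows "\<exists>N. finite N \<and>
    (\<forall>A\<in>N. set_word_expr A \<subseteq> Pow AP \<and> len (denot A) < \<omega> * \<omega> \<and> first (denot A) = \<sigma> \<and>
       0 < len (denot A) \<and> (\<forall>u\<in>U. \<not> emb_after u (denot A) 0)) \<and>
    (\<forall>v\<in>lists (Pow AP). (\<forall>u\<in>U. \<not> list_emb (\<subseteq>) u v) \<longrightarrow> (\<exists>A\<in>N. emb_after v (denot A) 0))"
  using assms(2,3)
proof (induction "sum length U" arbitrary: U \<sigma> rule: less_induct)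
  case less
  show ?case
  proof (cases "[] \<in> U")
    case True
    \<comment> \<open>The empty chain embeds in every list, so no list is left to dominate.\<close>
    then show ?thesis by (intro exI[of _ "{}"]) auto
  next
    case False
    \<comment> \<open>Letters that start no chain of \<open>U\<close>; \<open>hd\<close> is
      meaningful since the chains are nonempty here. They can recur forever without advancing any
      chain, while a letter of \<open>B\<close> advances at least one.\<close>
    define C where "C = {c \<in> Pow AP. \<forall>u\<in>U. \<not> hd u \<subseteq> c}"
    define B where "B = Pow AP - C"
    have "C \<subseteq> Pow AP" by (auto simp: C_def)
    have fin: "finite C" "finite B" using assms(1) by (auto simp: B_def C_def)
    obtain A where A: "set_word_expr A \<subseteq> Pow AP" "first (denot A) = \<sigma>" "0 < len (denot A)"
      "\<And>\<beta>. 0 < \<beta> \<Longrightarrow> \<beta> < len (denot A) \<Longrightarrow> letter (denot A) \<beta> \<in> C"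
      "\<And>\<alpha> c. \<alpha> < len (denot A) \<Longrightarrow> c \<in> C \<Longrightarrow> \<exists>\<beta>>\<alpha>. \<beta> < len (denot A) \<and> letter (denot A) \<beta> = c"
      "len (denot A) \<le> 1 + \<omega>"
      by (rule repeating_word[OF fin(1) \<open>C \<subseteq> Pow AP\<close> less.prems(2)]) (rule that; simp)
    have small: "len (denot A) + \<alpha> < \<omega> * \<omega>" if "\<alpha> < \<omega> * \<omega>" for \<alpha>
      using cord_add_right_mono[OF A(6), of \<alpha>]
        one_add_less_omega_squared[OF omega_add_less_omega_squared[OF that]]
      by (simp add: cord_add_assoc)
    let ?ok = "\<lambda>b N. finite N \<and>
      (\<forall>A\<in>N. set_word_expr A \<subseteq> Pow AP \<and> len (denot A) < \<omega> * \<omega> \<and> first (denot A) = b \<and>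
         0 < len (denot A) \<and> (\<forall>u\<in>residual b ` U. \<not> emb_after u (denot A) 0)) \<and>
      (\<forall>v\<in>lists (Pow AP). (\<forall>u\<in>residual b ` U. \<not> list_emb (\<subseteq>) u v) \<longrightarrow>
         (\<exists>A\<in>N. emb_after v (denot A) 0))"
    have "\<exists>N. ?ok b N" if "b \<in> B" for b
    proof (rule less.hyps)
      obtain u where u: "u \<in> U" "hd u \<subseteq> b" using \<open>b \<in> B\<close> by (auto simp: B_def C_def)
      with False have "length (residual b u) < length u" by (auto simp: residual_def)
      \<comment> \<open>The letter \<open>b\<close> shortens \<open>u\<close> and lengthens no
        chain. As \<open>residual b\<close> may identify chains, the sum over the image is only
        bounded by this one.\<close>
      then have "(\<Sum>u\<in>U. length (residual b u)) < sum length U"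
        using less.prems(1) u(1) by (intro sum_strict_mono_ex1) (auto simp: length_residual_le)
      moreover have "sum length (residual b ` U) \<le> (\<Sum>u\<in>U. length (residual b u))"
        using sum_image_le[of U length "residual b"] less.prems(1) by (simp add: o_def)
      ultimately show "sum length (residual b ` U) < sum length U" by simp
      show "finite (residual b ` U)" using less.prems(1) by simp
      show "b \<subseteq> AP" using that by (auto simp: B_def)
    qed
    then have "\<forall>b\<in>B. \<exists>N. ?ok b N" by (rule ballI)
    then obtain N where ok: "\<forall>b\<in>B. ?ok b (N b)" by (rule bchoice[THEN exE])
    note N = bspec[OF ok]
    \<comment> \<open>The separating letter \<open>b\<close> is not inserted between the factors: it
      is the first letter of every word in \<open>N b\<close>.\<close>
    let ?N = "insert A (\<Union>b\<in>B. Concat A ` N b)"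
    have no_head: "\<not> a \<subseteq> letter (denot A) \<beta>"
      if "a # us \<in> U" "0 < \<beta>" "\<beta> < len (denot A)" for a us \<beta>
      using A(4)[OF that(2,3)] that(1) unfolding C_def
      by (metis (no_types, lifting) list.sel(1) mem_Collect_eq)
    show ?thesis
    proof (intro exI[of _ ?N] conjI ballI impI)
      show "finite ?N" using fin N by auto
    next
      fix D assume "D \<in> ?N"
      then consider "D = A" | b D' where "b \<in> B" "D' \<in> N b" "D = Concat A D'" by auto
      then have "set_word_expr D \<subseteq> Pow AP \<and> len (denot D) < \<omega> * \<omega> \<and> first (denot D) = \<sigma> \<and>
       0 < len (denot D) \<and> (\<forall>u\<in>U. \<not> emb_after u (denot D) 0)"
      proof cases
        case 1
        have "\<not> emb_after u (denot A) 0" if "u \<in> U" for u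
          using that False no_head by (cases u) auto
        moreover have "len (denot A) < \<omega> * \<omega>"
          using small[of 0] omega_less_omega_squared
          by (metis cord_add_0_right less_trans zero_less_omega)
        ultimately show ?thesis using 1 A by auto
      next
        case 2
        have D': "set_word_expr D' \<subseteq> Pow AP" "len (denot D') < \<omega> * \<omega>" "first (denot D') = b"
          "\<And>u. u \<in> U \<Longrightarrow> \<not> emb_after (residual b u) (denot D') 0"
          using N[OF 2(1)] 2(2) by auto
        have "\<not> emb_after u (concat_word (denot A) (denot D')) 0" if u: "u \<in> U" for u
        proof (cases u)
          case (Cons a us)
          show ?thesis
          proof
            assume "emb_after u (concat_word (denot A) (denot D')) 0"
            \<comment> \<open>No letter of \<open>denot A\<close> after the first contains
              \<open>a\<close>, so \<open>a\<close> is matched in \<open>denot D'\<close>, on its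
              first letter \<open>b\<close> or later. If \<open>a \<subseteq> b\<close>, the
              residual is \<open>us\<close>, which embeds in both cases.\<close>
            then have "a \<subseteq> b \<and> emb_after us (denot D') 0 \<or> emb_after u (denot D') 0"
              using emb_after_concat_wordD[of a us "denot A" "denot D'"] no_head u D'(3)
              unfolding Cons by blast
            then have "emb_after (residual b u) (denot D') 0"
              using emb_after_ConsD[of a us] by (auto simp: residual_def Cons simp del: emb_after.simps)
            then show False using D'(4) u by blast
          qed
        qed (use u False in simp)
        then show ?thesis
          using 2(3) A(1-3) D' small less_le_trans[OF A(3) cord_le_add] by (auto simp: first_concat_word)
      qed
      then show "set_word_expr D \<subseteq> Pow AP" "len (denot D) < \<omega> * \<omega>" "first (denot D) = \<sigma>"
        "0 < len (denot D)" "\<And>u. u \<in> U \<Longrightarrow> \<not> emb_after u (denot D) 0" by auto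
    next
      fix v assume v: "v \<in> lists (Pow AP)" "\<forall>u\<in>U. \<not> list_emb (\<subseteq>) u v"
      define xs where "xs = takeWhile (\<lambda>c. c \<in> C) v"
      have xs: "xs \<in> lists C" by (auto simp: xs_def dest: set_takeWhileD)
      show "\<exists>D\<in>?N. emb_after v (denot D) 0"
      proof (cases "dropWhile (\<lambda>c. c \<in> C) v")
        case Nil
        then have "v = xs @ []" by (metis takeWhile_dropWhile_id xs_def)
        moreover have "emb_after (xs @ []) (denot A) 0"
          by (rule emb_after_append[where C = C and m = "len (denot A)"]) (use A xs in auto)
        ultimately show ?thesis by auto
      next
        case (Cons b v')
        then have veq: "v = xs @ b # v'" by (metis takeWhile_dropWhile_id xs_def)
        have "b \<notin> C" using Cons by (metis hd_dropWhile list.distinct(1) list.sel(1))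
        with veq v(1) have b: "b \<in> B" "v' \<in> lists (Pow AP)" by (auto simp: B_def)
        have "\<not> list_emb (\<subseteq>) (residual b u) v'" if "u \<in> U" for u
          using list_emb_residual[of b u v'] v(2) that list_emb_append2[of "(\<subseteq>)" u "b # v'" xs]
          unfolding veq by blast
        then have "\<forall>u\<in>residual b ` U. \<not> list_emb (\<subseteq>) u v'" by simp
        then obtain D where D: "D \<in> N b" "emb_after v' (denot D) 0"
          using bspec[OF N[OF b(1), THEN conjunct2, THEN conjunct2] b(2)] by blast
        then have D': "first (denot D) = b" "0 < len (denot D)" using N[OF b(1)] by auto
        let ?w = "concat_word (denot A) (denot D)"
        \<comment> \<open>The block \<open>A\<close> absorbs \<open>xs\<close>, the first letter of
          \<open>D\<close> matches \<open>b\<close>, and the rest of \<open>D\<close> absorbs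
          \<open>v'\<close>.\<close>
        have "emb_after (xs @ b # v') ?w 0"
        proof (rule emb_after_append[where C = C and m = "len (denot A)"])
          show "emb_after (b # v') ?w \<alpha>" if "\<alpha> < len (denot A)" for \<alpha>
            using that D D' by (intro emb_after_concat_wordI) auto
          show "\<exists>\<beta>>\<alpha>. \<beta> < len (denot A) \<and> letter ?w \<beta> = c"
            if "\<alpha> < len (denot A)" "c \<in> C" for \<alpha> c
            using A(5)[OF that] by (auto simp: letter_concat_word_left)
        qed (use A xs in \<open>auto simp: cord_le_add\<close>)
        then show ?thesis using D(1) b(1) veq by auto
      qed
    qed
  qed
qed

section \<open>Assembling the labeled examples\<close>

lemma ltl_Fhat_characterization:
  fixes AP :: "'p set"
  assumes AP: "finite AP" and \<phi>: "\<phi> \<in> ltl_Fhat AP"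
  shows "\<exists>E. finite E \<and> E \<subseteq> all_words AP \<times> UNIV \<and>
       (\<forall>(w, l)\<in>E. finitely_presentable AP w \<and> len w < \<omega> * \<omega>) \<and>
       uniquely_characterizes AP (ltl_Fhat AP) E \<phi>"
proof -
  obtain P where P: "finite P" "P \<subseteq> Pow AP \<times> lists (Pow AP)"
    "\<And>w. sat \<phi> w \<longleftrightarrow> (\<exists>u\<in>P. chain u w)"
    using ltl_Fhat_normal_form[OF \<phi>] unfolding normal_form_def by blast
  \<comment> \<open>On words with first letter \<sigma> only chains whose head is contained in
    \<sigma> can hold, and for these the tail decides.\<close>
  define U where "U \<sigma> = snd ` {u \<in> P. fst u \<subseteq> \<sigma>}" for \<sigma>
  let ?ok = "\<lambda>\<sigma> M. finite M \<and>
    (\<forall>A\<in>M. set_word_expr A \<subseteq> Pow AP \<and> len (denot A) < \<omega> * \<omega> \<and> first (denot A) = \<sigma> \<and>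
       0 < len (denot A) \<and> (\<forall>u\<in>U \<sigma>. \<not> emb_after u (denot A) 0)) \<and>
    (\<forall>v\<in>lists (Pow AP). (\<forall>u\<in>U \<sigma>. \<not> list_emb (\<subseteq>) u v) \<longrightarrow> (\<exists>A\<in>M. emb_after v (denot A) 0))"
  have "\<forall>\<sigma>\<in>Pow AP. \<exists>M. ?ok \<sigma> M"
    using P(1) by (intro ballI avoiding_words[OF AP]) (simp_all add: U_def)
  then obtain N where ok: "\<forall>\<sigma>\<in>Pow AP. ?ok \<sigma> (N \<sigma>)"
    by (rule bchoice[THEN exE])
  have N: "finite (N \<sigma>)"
    "A \<in> N \<sigma> \<Longrightarrow> set_word_expr A \<subseteq> Pow AP \<and> len (denot A) < \<omega> * \<omega> \<and> first (denot A) = \<sigma> \<and>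
       (\<forall>u\<in>U \<sigma>. \<not> emb_after u (denot A) 0)"
    "v \<in> lists (Pow AP) \<Longrightarrow> \<forall>u\<in>U \<sigma>. \<not> list_emb (\<subseteq>) u v \<Longrightarrow> \<exists>A\<in>N \<sigma>. emb_after v (denot A) 0"
    if "\<sigma> \<in> Pow AP" for \<sigma> A v
    using bspec[OF ok that] by simp_all
  define pos where "pos = (\<lambda>(a, us). finite_word a us) ` P"
  define neg where "neg = (\<Union>\<sigma>\<in>Pow AP. N \<sigma>)"
  define E where "E = (\<lambda>A. (denot A, Pos)) ` pos \<union> (\<lambda>A. (denot A, Neg)) ` neg"
  have pos: "set_word_expr A \<subseteq> Pow AP \<and> len (denot A) < \<omega> * \<omega>" if "A \<in> pos" for A
  proof -
    obtain a us where u: "(a, us) \<in> P" and A: "A = finite_word a us"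
      using \<open>A \<in> pos\<close> by (auto simp: pos_def)
    have "a \<in> Pow AP" "us \<in> lists (Pow AP)" using u P(2) by blast+
    then have "set_word_expr A \<subseteq> Pow AP" by (auto simp: A set_finite_word)
    moreover have "len (denot A) < \<omega> * \<omega>"
      using len_finite_word omega_less_omega_squared less_trans unfolding A by blast
    ultimately show ?thesis ..
  qed
  have neg: "set_word_expr A \<subseteq> Pow AP \<and> len (denot A) < \<omega> * \<omega>" if "A \<in> neg" for A
  proof -
    obtain \<sigma> where \<sigma>: "\<sigma> \<in> Pow AP" "A \<in> N \<sigma>"
      using \<open>A \<in> neg\<close> by (auto simp: neg_def)
    then show ?thesis using N(2)[OF \<sigma>] by simp
  qed
  have word: "denot A \<in> all_words AP \<and> finitely_presentable AP (denot A) \<and> len (denot A) < \<omega> * \<omega>"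
    if "A \<in> pos \<union> neg" for A
  proof -
    have A: "set_word_expr A \<subseteq> Pow AP" "len (denot A) < \<omega> * \<omega>" using that pos neg by blast+
    then have "denot A \<in> all_words AP" using denot_in_all_words by blast
    with A show ?thesis unfolding finitely_presentable_def by blast
  qed
  have "finite E" using P(1) N(1) AP by (auto simp: E_def pos_def neg_def)
  moreover have "E \<subseteq> all_words AP \<times> UNIV"
    using word by (auto simp: E_def)
  moreover have "\<forall>(w, l)\<in>E. finitely_presentable AP w \<and> len w < \<omega> * \<omega>"
    using word by (auto simp: E_def)
  moreover have "fits \<phi> e" if "e \<in> E" for e
  proof -
    have "sat \<phi> (denot A)" if "A \<in> pos" for A
    proof -
      obtain a us where "(a, us) \<in> P" "A = finite_word a us"
        using \<open>A \<in> pos\<close> by (auto simp: pos_def)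
      moreover have "chain (a, us) (denot (finite_word a us))"
        by (simp add: chain_finite_word list_emb_refl)
      ultimately show ?thesis using P(3) by blast
    qed
    moreover have "\<not> sat \<phi> (denot A)" if "A \<in> neg" for A
    proof
      obtain \<sigma> where \<sigma>: "\<sigma> \<in> Pow AP" "A \<in> N \<sigma>"
        using \<open>A \<in> neg\<close> by (auto simp: neg_def)
      assume "sat \<phi> (denot A)"
      then obtain u where "u \<in> P" "fst u \<subseteq> \<sigma>" "emb_after (snd u) (denot A) 0"
        using N(2)[OF \<sigma>] by (auto simp: P(3) chain_def)
      moreover from this have "snd u \<in> U \<sigma>" by (simp add: U_def)
      ultimately show False using N(2)[OF \<sigma>] by blast
    qed
    ultimately show ?thesis using that by (auto simp: E_def fits_def)
  qed
  moreover have "models AP \<psi> = models AP \<phi>" if \<psi>: "\<psi> \<in> ltl_Fhat AP" and fit: "\<forall>e\<in>E. fits \<psi> e" for \<psi>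
  proof -
    obtain Q where Q: "Q \<subseteq> Pow AP \<times> lists (Pow AP)" "\<And>w. sat \<psi> w \<longleftrightarrow> (\<exists>u\<in>Q. chain u w)"
      using ltl_Fhat_normal_form[OF \<psi>] unfolding normal_form_def by blast
    \<comment> \<open>A chain of \<phi> that holds in \<open>w\<close> is, as a finite word, a
      positive example; the chain of \<psi> that holds there embeds in it and so holds in
      \<open>w\<close> as well.\<close>
    have "sat \<psi> w" if "sat \<phi> w" for w
    proof -
      obtain a us where u: "(a, us) \<in> P" "chain (a, us) w" using \<open>sat \<phi> w\<close> P(3) by auto
      then have "finite_word a us \<in> pos" by (force simp: pos_def)
      then have "sat \<psi> (denot (finite_word a us))"
        using fit by (fastforce simp: E_def fits_def)
      then obtain b vs where "(b, vs) \<in> Q" "chain (b, vs) (denot (finite_word a us))"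
        using Q(2) by auto
      then show ?thesis using chain_mono u(2) Q(2) unfolding chain_finite_word by blast
    qed
    \<comment> \<open>If \<phi> fails in \<open>w\<close>, a chain \<open>(a, vs)\<close> of \<psi>
      true in \<open>w\<close> has a tail avoiding \<open>U a\<close>. Some negative example with
      first letter \<open>a\<close>, the head of the chain and not the first letter of
      \<open>w\<close>, then dominates \<open>vs\<close> and satisfies \<psi>.\<close>
    moreover have "sat \<phi> w" if "sat \<psi> w" for w
    proof (rule ccontr)
      assume w: "\<not> sat \<phi> w"
      obtain a vs where v: "(a, vs) \<in> Q" "chain (a, vs) w" using \<open>sat \<psi> w\<close> Q(2) by auto
      then have a: "a \<in> Pow AP" "vs \<in> lists (Pow AP)" using Q(1) by auto
      have "\<forall>u\<in>U a. \<not> list_emb (\<subseteq>) u vs"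
        using w chain_mono[OF _ _ v(2)] by (auto simp: U_def P(3))
      then obtain A where A: "A \<in> N a" "emb_after vs (denot A) 0"
        using N(3)[OF a] by blast
      then have "chain (a, vs) (denot A)" using N(2)[OF a(1) A(1)] by (simp add: chain_def)
      then have "sat \<psi> (denot A)" using v(1) Q(2) by blast
      moreover have "(denot A, Neg) \<in> E" using A(1) a(1) by (auto simp: E_def neg_def)
      ultimately show False using fit by (auto simp: fits_def)
    qed
    ultimately show ?thesis by (auto simp: models_def)
  qed
  ultimately show ?thesis
    unfolding uniquely_characterizes_def by (intro exI[of _ E] conjI ballI impI) simp_all
qed

theorem theorem16:
  fixes AP :: "'p set"
  assumes "finite AP"
  shows "admits_finite_characterizations AP (ltl_Fhat AP) \<and>
    (\<forall>\<phi>\<in>ltl_Fhat AP. \<exists>E. finite E \<and> E \<subseteq> all_words AP \<times> UNIV \<and>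
       (\<forall>(w, l)\<in>E. finitely_presentable AP w \<and> len w < \<omega> * \<omega>) \<and>
       uniquely_characterizes AP (ltl_Fhat AP) E \<phi>)"
  using ltl_Fhat_characterization[OF assms]
  unfolding admits_finite_characterizations_def by blast

end
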